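(* For $(a,x_1,x_2,x_3)\in\mathbb C^4$, let $\beta=1-|x_1|^2-|x_2|^2+|x_3|^2$ and let $w\in\mathbb C$ satisfy $w^2=x_1x_2-x_3$. Then the following are equivalent: (1) $(a,x_1,x_2,x_3)\in\mathbb H_N$; (2) $(x_1,x_2,x_3)\in\mathbb E$ and one of the following holds: $(a,x_1,x_2,x_3)=(0,x_1,x_2,x_1x_2)$, or $$a\neq0\quad\text{and}\quad \frac{\beta-\sqrt{\beta^2-4|w|^4}}{2}<|a|^2<\frac{\beta+\sqrt{\beta^2-4|w|^4}}{2};$$ (3) $(x_1,x_2,x_3)\in\mathbb E$ and one of the following holds: $(a,x_1,x_2,x_3)=(0,x_1,x_2,x_1x_2)$, or $$a\neq0\quad\text{and}\quad \det(I-A^*A)>0\ \text{ for } A=\begin{pmatrix}x_1& w^2/a\\ a& x_2\end{pmatrix}.$$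
   Context: $\|\cdot\|$ is the operator norm on $M_2(\mathbb C)$ induced by the Euclidean norm on $\mathbb C^2$; $A^*$ is the adjoint of $A$; $\overline{\mathbb D}$ is the closed unit disc. $\pi:M_2(\mathbb C)\to\mathbb C^4$ is $\pi((a_{ij}))=(a_{21},a_{11},a_{22},\det(A))$, and the normed hexablock is $\mathbb H_N=\{\pi(A): A\in M_2(\mathbb C),\ \|A\|<1\}$. The tetrablock is $\mathbb E=\{(x_1,x_2,x_3)\in\mathbb C^3: 1-x_1z_1-x_2z_2+x_3z_1z_2\ne0 \text{ for all } z_1,z_2\in\overline{\mathbb D}\}$. For $(x_1,x_2,x_3)\in\mathbb E$ one has $\beta^2-4|w|^4\geq 0$, so the real square root in (2) makes sense. *)

theory Defs
  imports "HOL-Analysis.Analysis" "HOL-Library.Complex_Order"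
begin

(* Complex_Order: for complex z, 0 < z means that z is real and positive. *)

definition cadjoint :: "complex^'n^'m \<Rightarrow> complex^'m^'n" where
  "cadjoint A = (\<chi> i j. cnj (A $ j $ i))"

(* The norm on complex^'n is the Euclidean one, so onorm of the induced map is the
   operator norm with respect to the Euclidean norms. *)
definition opnorm :: "complex^'n^'m \<Rightarrow> real" where
  "opnorm A = onorm (\<lambda>v. A *v v)"

definition hexa_pi :: "complex^2^2 \<Rightarrow> complex \<times> complex \<times> complex \<times> complex" where
  "hexa_pi A = (A $ 2 $ 1, A $ 1 $ 1, A $ 2 $ 2, det A)"

definition normed_hexablock :: "(complex \<times> complex \<times> complex \<times> complex) set" where
  "normed_hexablock = {hexa_pi A | A. opnorm A < 1}"

definition tetrablock :: "(complex \<times> complex \<times> complex) set" where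
  "tetrablock = {(x1, x2, x3). \<forall>z1\<in>cball 0 1. \<forall>z2\<in>cball 0 1.
     1 - x1 * z1 - x2 * z2 + x3 * z1 * z2 \<noteq> 0}"

(* Matrix with rows (a, b) and (c, d). *)
definition mat22 :: "complex \<Rightarrow> complex \<Rightarrow> complex \<Rightarrow> complex \<Rightarrow> complex^2^2" where
  "mat22 a b c d = vector [vector [a, b], vector [c, d]]"

end

theory Submission
  imports Defs
begin

text \<open>
  A point \<open>(a, x\<^sub>1, x\<^sub>2, x\<^sub>3)\<close> lies in the normed hexablock iff some strict contraction
  \<open>A\<close> has diagonal \<open>x\<^sub>1, x\<^sub>2\<close>, lower left entry \<open>a\<close> and determinant \<open>x\<^sub>3\<close>.  Only the upper right
  entry \<open>b\<close> is free, subject to \<open>a b = x\<^sub>1 x\<^sub>2 - x\<^sub>3 = w\<^sup>2\<close>.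

  If \<open>a = 0\<close>, then \<open>x\<^sub>3 = x\<^sub>1 x\<^sub>2\<close> and the best choice is \<open>b = 0\<close>: a diagonal matrix is a strict
  contraction as soon as its entries have modulus below 1, which the tetrablock forces.

  If \<open>a \<noteq> 0\<close>, then \<open>b = w\<^sup>2 / a\<close> is determined, and \<open>A\<close> is a strict contraction iff the
  Hermitian matrix \<open>I - A\<^sup>*A\<close> is positive definite, that is, iff its trace and its determinant are
  positive (\<open>opnorm_mat22_less_1_iff\<close>).  The determinant equals
  \<open>\<beta> - |a|\<^sup>2 - |w|\<^sup>4 / |a|\<^sup>2\<close>, so its positivity is a quadratic inequality in \<open>|a|\<^sup>2\<close>, whose solutions
  are the points strictly between the two roots (\<open>between_roots_iff\<close>).  What remains is to trade
  the trace condition for membership in the tetrablock.  In one direction, \<open>A\<close> composed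
  with a diagonal contraction cannot have a fixed vector (\<open>tetrablock_of_contraction\<close>).  In the other,
  a positive determinant makes the trace exceed \<open>1 - |x\<^sub>3|\<^sup>2\<close>, and \<open>|x\<^sub>3| < 1\<close> throughout
  the tetrablock (\<open>tetrablock_third_less_1\<close>).
\<close>

section \<open>Strict contractions among 2 by 2 complex matrices\<close>

lemma norm_vec2_squared:
  fixes v :: "complex^2"
  shows "(norm v)\<^sup>2 = (cmod (v $ 1))\<^sup>2 + (cmod (v $ 2))\<^sup>2"
  by (simp add: norm_vec_def L2_set_def sum_2)

lemma mat22_nth [simp]:
  "mat22 a b c d $ 1 $ 1 = a" "mat22 a b c d $ 1 $ 2 = b"
  "mat22 a b c d $ 2 $ 1 = c" "mat22 a b c d $ 2 $ 2 = d"
  by (simp_all add: mat22_def)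

lemma mat22_eta: "mat22 (A $ 1 $ 1) (A $ 1 $ 2) (A $ 2 $ 1) (A $ 2 $ 2) = A"
  by (simp add: vec_eq_iff forall_2)

lemma mat22_mult_vec:
  "(mat22 a b c d *v v) $ 1 = a * v $ 1 + b * v $ 2"
  "(mat22 a b c d *v v) $ 2 = c * v $ 1 + d * v $ 2"
  by (simp_all add: matrix_vector_mult_def sum_2)

lemma norm_mult_vec_less:
  fixes A :: "complex^'n^'m"
  assumes "opnorm A < 1" "v \<noteq> 0"
  shows "norm (A *v v) < norm v"
proof -
  have "norm (A *v v) \<le> onorm ((*v) A) * norm v"
    by (rule onorm) simp
  also have "\<dots> < 1 * norm v"
    using assms by (intro mult_strict_right_mono) (simp_all add: opnorm_def)
  finally show ?thesis by simp
qed

text \<open>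
  A pointwise strict inequality would need compactness of the unit sphere to bound the supremum away
  from 1; the quadratic gap \<open>c\<close> bounds it explicitly, by \<open>sqrt (1 - c)\<close>.
\<close>
lemma opnorm_less_1I:
  fixes A :: "complex^'n^'m"
  assumes "0 < c" and gap: "\<And>v. c * (norm v)\<^sup>2 \<le> (norm v)\<^sup>2 - (norm (A *v v))\<^sup>2"
  shows "opnorm A < 1"
proof -
  \<comment> \<open>The maximum covers \<open>c > 1\<close>, where \<open>1 - c\<close> has no real square root.\<close>
  define k where "k = max 0 (1 - c)"
  have k: "0 \<le> k" "k < 1" "1 - c \<le> k"
    using \<open>0 < c\<close> by (auto simp: k_def)
  have "norm (A *v v) \<le> sqrt k * norm v" for v
  proof (rule power2_le_imp_le)
    have "(norm (A *v v))\<^sup>2 \<le> (1 - c) * (norm v)\<^sup>2"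
      using gap[of v] by (simp add: algebra_simps)
    also have "\<dots> \<le> k * (norm v)\<^sup>2"
      using k by (intro mult_right_mono) auto
    finally show "(norm (A *v v))\<^sup>2 \<le> (sqrt k * norm v)\<^sup>2"
      using k by (simp add: power_mult_distrib)
  qed (use k in simp)
  then have "opnorm A \<le> sqrt k"
    unfolding opnorm_def by (intro onorm_le) auto
  also have "sqrt k < 1"
    using k by simp
  finally show ?thesis .
qed

text \<open>
  For the Hermitian matrix \<open>M\<close> with rows \<open>(p, q)\<close> and \<open>(cnj q, r)\<close>, the Cayley-Hamilton identity
  \<open>tr M \<cdot> M - det M \<cdot> I = M\<^sup>2\<close>, applied to \<open>(u, v)\<close> and paired with \<open>(u, v)\<close>, gives
  this formula.  Its right-hand side being nonnegative, the form of \<open>M\<close> is at least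
  \<open>det M / tr M\<close> times the squared norm when the trace is positive.
\<close>
lemma hermitian_form_Cayley_Hamilton:
  fixes p r :: real and q u v :: complex
  shows "(p + r) * (p * (cmod u)\<^sup>2 + 2 * Re (cnj u * q * v) + r * (cmod v)\<^sup>2)
      - (p * r - (cmod q)\<^sup>2) * ((cmod u)\<^sup>2 + (cmod v)\<^sup>2)
    = (cmod (p * u + q * v))\<^sup>2 + (cmod (cnj q * u + r * v))\<^sup>2"
  unfolding cmod_power2 by simp algebra

text \<open>
  Here \<open>p\<close>, \<open>q\<close>, \<open>r\<close> are the entries of the Hermitian matrix \<open>I - A\<^sup>*A\<close>, whose quadratic form
  measures by how much \<open>A\<close> shrinks a vector.
\<close>
lemma norm_defect_mat22:
  fixes x b a y :: complex and v :: "complex^2"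
  defines "p \<equiv> 1 - (cmod x)\<^sup>2 - (cmod a)\<^sup>2" and "r \<equiv> 1 - (cmod b)\<^sup>2 - (cmod y)\<^sup>2"
    and "q \<equiv> - (cnj x * b + cnj a * y)"
  shows "(norm v)\<^sup>2 - (norm (mat22 x b a y *v v))\<^sup>2
    = p * (cmod (v $ 1))\<^sup>2 + 2 * Re (cnj (v $ 1) * q * v $ 2) + r * (cmod (v $ 2))\<^sup>2"
  unfolding norm_vec2_squared mat22_mult_vec cmod_power2 p_def q_def r_def by simp algebra

text \<open>
  The left-hand side is \<open>p r - |q|\<^sup>2\<close> for the entries of \<open>I - A\<^sup>*A\<close>.  It agrees with the value
  \<open>1 - tr (A\<^sup>*A) + det (A\<^sup>*A)\<close> of the characteristic polynomial of \<open>A\<^sup>*A\<close> at 1.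
\<close>
lemma det_defect_real:
  fixes x b a y :: complex
  shows "(1 - (cmod x)\<^sup>2 - (cmod a)\<^sup>2) * (1 - (cmod b)\<^sup>2 - (cmod y)\<^sup>2)
      - (cmod (- (cnj x * b + cnj a * y)))\<^sup>2
    = 1 - (cmod x)\<^sup>2 - (cmod a)\<^sup>2 - (cmod b)\<^sup>2 - (cmod y)\<^sup>2 + (cmod (x * y - b * a))\<^sup>2"
  unfolding cmod_power2 by simp algebra

lemma det_defect:
  fixes x b a y :: complex
  shows "det (mat 1 - cadjoint (mat22 x b a y) ** mat22 x b a y) = complex_of_real
    (1 - (cmod x)\<^sup>2 - (cmod a)\<^sup>2 - (cmod b)\<^sup>2 - (cmod y)\<^sup>2 + (cmod (x * y - b * a))\<^sup>2)"
  unfolding det_defect_real[symmetric] of_real_diff of_real_mult of_real_1 complex_norm_square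
  by (simp add: det_2 cadjoint_def matrix_matrix_mult_def mat_def sum_2)
     (simp add: algebra_simps)

text \<open>
  The two inequalities say that \<open>I - A\<^sup>*A\<close> has positive trace \<open>2 - s\<close> and positive determinant,
  hence that it is positive definite.
\<close>
theorem opnorm_mat22_less_1_iff:
  fixes x b a y :: complex
  defines "s \<equiv> (cmod x)\<^sup>2 + (cmod a)\<^sup>2 + (cmod b)\<^sup>2 + (cmod y)\<^sup>2"
  shows "opnorm (mat22 x b a y) < 1 \<longleftrightarrow> s < 2 \<and> s < 1 + (cmod (x * y - b * a))\<^sup>2"
proof -
  define p where "p = 1 - (cmod x)\<^sup>2 - (cmod a)\<^sup>2"
  define r where "r = 1 - (cmod b)\<^sup>2 - (cmod y)\<^sup>2"
  define q where "q = - (cnj x * b + cnj a * y)"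
  define h where "h v = (norm v)\<^sup>2 - (norm (mat22 x b a y *v v))\<^sup>2" for v
  define d where "d = p * r - (cmod q)\<^sup>2"
  have h: "h v = p * (cmod (v $ 1))\<^sup>2 + 2 * Re (cnj (v $ 1) * q * v $ 2) + r * (cmod (v $ 2))\<^sup>2" for v
    unfolding h_def p_def q_def r_def by (rule norm_defect_mat22)
  have T: "p + r = 2 - s"
    by (simp add: p_def r_def s_def)
  have d: "d = 1 - s + (cmod (x * y - b * a))\<^sup>2"
    using det_defect_real[of x a b y] unfolding d_def p_def q_def r_def s_def by linarith
  have "opnorm (mat22 x b a y) < 1 \<longleftrightarrow> 0 < p + r \<and> 0 < d"
  proof
    assume "opnorm (mat22 x b a y) < 1"
    then have pos: "0 < h v" if "v \<noteq> 0" for v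
      using norm_mult_vec_less[OF _ that, of "mat22 x b a y"] by (simp add: h_def power_strict_mono)
    have p: "0 < p"
      using pos[of "vector [1, 0]"] by (simp add: h vec_eq_iff forall_2)
    \<comment> \<open>The matrix with rows \<open>(p, q)\<close> and \<open>(cnj q, r)\<close> maps \<open>(- q, p)\<close> to \<open>(0, d)\<close>, so the form takes the value \<open>p d\<close> there.\<close>
    have "0 < h (vector [- q, p])"
      using p by (intro pos) (simp add: vec_eq_iff forall_2)
    also have "h (vector [- q, p]) = p * d"
      unfolding h d_def vector_2 cmod_power2 by simp algebra
    finally have d: "0 < d"
      using p by (simp add: zero_less_mult_iff)
    then have "0 < p * r"
      unfolding d_def by (smt (verit) zero_le_power2)
    with p d show "0 < p + r \<and> 0 < d"
      by (simp add: zero_less_mult_iff)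
  next
    assume *: "0 < p + r \<and> 0 < d"
    show "opnorm (mat22 x b a y) < 1"
    proof (rule opnorm_less_1I)
      show "0 < d / (p + r)"
        using * by simp
      fix v :: "complex^2"
      have "d * (norm v)\<^sup>2 \<le> (p + r) * h v"
        using hermitian_form_Cayley_Hamilton[of p r "v $ 1" q "v $ 2"]
        unfolding h norm_vec2_squared d_def by (smt (verit) zero_le_power2)
      then show "d / (p + r) * (norm v)\<^sup>2 \<le> (norm v)\<^sup>2 - (norm (mat22 x b a y *v v))\<^sup>2"
        using * by (simp add: h_def field_simps)
    qed
  qed
  then show ?thesis
    unfolding T d by auto
qed

section \<open>The tetrablock\<close>

text \<open>
  The polynomial defining the tetrablock is \<open>det (I - A D)\<close> with \<open>D\<close> the diagonal matrix of
  \<open>z\<^sub>1, z\<^sub>2\<close>.  If it vanishes, then \<open>A D v = v\<close> for some \<open>v \<noteq> 0\<close>, which is impossible because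
  \<open>D\<close> does not increase norms and \<open>A\<close> strictly decreases them.
\<close>
lemma tetrablock_of_contraction:
  assumes "opnorm (mat22 x b a y) < 1"
  shows "(x, y, x * y - b * a) \<in> tetrablock"
  unfolding tetrablock_def
proof (clarify)
  fix z1 z2 :: complex
  assume z: "z1 \<in> cball 0 1" "z2 \<in> cball 0 1"
    and eq: "1 - x * z1 - y * z2 + (x * y - b * a) * z1 * z2 = 0"
  define M where "M = mat22 (1 - x * z1) (- (b * z2)) (- (a * z1)) (1 - y * z2)"
  have "det M = 0"
    using eq by (simp add: M_def det_2 algebra_simps)
  then have "\<not> invertible M"
    by (simp add: invertible_det_nz)
  then obtain v where v: "M *v v = 0" "v \<noteq> 0"
    by (metis invertible_left_inverse matrix_left_invertible_ker)
  define u :: "complex^2" where "u = vector [z1 * v $ 1, z2 * v $ 2]"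
  have Au: "mat22 x b a y *v u = v"
    using v(1) by (simp add: vec_eq_iff forall_2 M_def mat22_mult_vec u_def algebra_simps)
  have "u \<noteq> 0"
    using Au v(2) by auto
  from norm_mult_vec_less[OF assms this] have "norm v < norm u"
    by (simp add: Au)
  moreover have "norm u \<le> norm v"
  proof (rule power2_le_imp_le)
    have "(cmod (z * t))\<^sup>2 \<le> (cmod t)\<^sup>2" if "z \<in> cball 0 1" for z t
      using that by (intro power_mono) (auto simp: norm_mult mult_left_le_one_le)
    then show "(norm u)\<^sup>2 \<le> (norm v)\<^sup>2"
      using z unfolding norm_vec2_squared by (simp add: u_def add_mono)
  qed simp
  ultimately show False by simp
qed

lemma tetrablock_swap: "(x1, x2, x3) \<in> tetrablock \<Longrightarrow> (x2, x1, x3) \<in> tetrablock"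
  unfolding tetrablock_def by (fastforce simp: algebra_simps)

lemma tetrablock_less_1:
  assumes "(x1, x2, x3) \<in> tetrablock"
  shows "cmod x1 < 1"
proof (rule ccontr)
  assume "\<not> cmod x1 < 1"
  then have "1 / x1 \<in> cball 0 1" "x1 \<noteq> 0"
    by (auto simp: norm_divide divide_simps)
  moreover have "(0::complex) \<in> cball 0 1"
    by simp
  ultimately have "1 - x1 * (1 / x1) - x2 * 0 + x3 * (1 / x1) * 0 \<noteq> 0"
    using assms unfolding tetrablock_def by blast
  with \<open>x1 \<noteq> 0\<close> show False
    by simp
qed

text \<open>
  The defining polynomial is affine in \<open>z\<^sub>1\<close>; the inequality says that its root
  \<open>z\<^sub>1 = (1 - x\<^sub>2 z) / (x\<^sub>1 - x\<^sub>3 z)\<close>, if there is one, lies outside the closed disc.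
\<close>
lemma tetrablock_cmod_less:
  assumes "(x1, x2, x3) \<in> tetrablock" "cmod z \<le> 1"
  shows "cmod (x1 - x3 * z) < cmod (1 - x2 * z)"
proof (rule ccontr)
  assume neg: "\<not> ?thesis"
  have z: "z \<in> cball 0 1"
    using assms by simp
  have "(0::complex) \<in> cball 0 1"
    by simp
  then have "1 - x1 * 0 - x2 * z + x3 * 0 * z \<noteq> 0"
    using assms z unfolding tetrablock_def by blast
  then have "1 - x2 * z \<noteq> 0"
    by simp
  then have nz: "x1 - x3 * z \<noteq> 0"
    using neg by auto
  define z1 where "z1 = (1 - x2 * z) / (x1 - x3 * z)"
  have "z1 \<in> cball 0 1"
    using neg nz by (simp add: z1_def norm_divide divide_simps)
  then have "1 - x1 * z1 - x2 * z + x3 * z1 * z \<noteq> 0"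
    using assms z unfolding tetrablock_def by blast
  moreover have "1 - x1 * z1 - x2 * z + x3 * z1 * z = (1 - x2 * z) - z1 * (x1 - x3 * z)"
    by (simp add: algebra_simps)
  ultimately show False
    using nz unfolding z1_def by (metis diff_self nonzero_eq_divide_eq)
qed

text \<open>
  Averaging the preceding inequality over \<open>z = 1\<close> and \<open>z = -1\<close> cancels the cross terms, by the
  parallelogram law.
\<close>
lemma tetrablock_square_sum_less:
  assumes "(x1, x2, x3) \<in> tetrablock"
  shows "(cmod x1)\<^sup>2 + (cmod x3)\<^sup>2 < 1 + (cmod x2)\<^sup>2"
proof -
  have parallelogram: "(cmod (u - v))\<^sup>2 + (cmod (u + v))\<^sup>2 = 2 * (cmod u)\<^sup>2 + 2 * (cmod v)\<^sup>2" for u v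
    unfolding cmod_power2 by simp algebra
  have "(cmod (x1 - x3))\<^sup>2 < (cmod (1 - x2))\<^sup>2"
    using tetrablock_cmod_less[OF assms, of 1] by (simp add: power_strict_mono)
  moreover have "(cmod (x1 + x3))\<^sup>2 < (cmod (1 + x2))\<^sup>2"
    using tetrablock_cmod_less[OF assms, of "-1"] by (simp add: power_strict_mono)
  ultimately have "2 * (cmod x1)\<^sup>2 + 2 * (cmod x3)\<^sup>2 < 2 * (cmod 1)\<^sup>2 + 2 * (cmod x2)\<^sup>2"
    unfolding parallelogram[symmetric] by (rule add_strict_mono)
  then show ?thesis by simp
qed

lemma tetrablock_third_less_1:
  assumes "(x1, x2, x3) \<in> tetrablock"
  shows "(cmod x3)\<^sup>2 < 1"
  using tetrablock_square_sum_less[OF assms]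
    tetrablock_square_sum_less[OF tetrablock_swap[OF assms]] by linarith

section \<open>The normed hexablock\<close>

lemma normed_hexablock_iff:
  "(a, x1, x2, x3) \<in> normed_hexablock \<longleftrightarrow>
    (\<exists>b. opnorm (mat22 x1 b a x2) < 1 \<and> x3 = x1 * x2 - b * a)"
proof
  assume "(a, x1, x2, x3) \<in> normed_hexablock"
  then obtain A :: "complex^2^2" where A: "opnorm A < 1" "a = A $ 2 $ 1" "x1 = A $ 1 $ 1" "x2 = A $ 2 $ 2" "x3 = det A"
    by (auto simp: normed_hexablock_def hexa_pi_def)
  then show "\<exists>b. opnorm (mat22 x1 b a x2) < 1 \<and> x3 = x1 * x2 - b * a"
    by (intro exI[of _ "A $ 1 $ 2"]) (simp add: mat22_eta det_2)
next
  assume "\<exists>b. opnorm (mat22 x1 b a x2) < 1 \<and> x3 = x1 * x2 - b * a"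
  then obtain b where b: "opnorm (mat22 x1 b a x2) < 1" "x3 = x1 * x2 - b * a"
    by blast
  have "hexa_pi (mat22 x1 b a x2) = (a, x1, x2, x3)"
    using b by (simp add: hexa_pi_def det_2)
  with b show "(a, x1, x2, x3) \<in> normed_hexablock"
    unfolding normed_hexablock_def by (metis (mono_tags, lifting) mem_Collect_eq)
qed

lemma normed_hexablock_imp_tetrablock:
  "(a, x1, x2, x3) \<in> normed_hexablock \<Longrightarrow> (x1, x2, x3) \<in> tetrablock"
  by (auto simp: normed_hexablock_iff intro: tetrablock_of_contraction)

lemma normed_hexablock_zero_iff:
  "(0, x1, x2, x3) \<in> normed_hexablock \<longleftrightarrow> (x1, x2, x3) \<in> tetrablock \<and> x3 = x1 * x2"
proof (intro iffI conjI)
  assume *: "(x1, x2, x3) \<in> tetrablock \<and> x3 = x1 * x2"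
  define s t where "s = (cmod x1)\<^sup>2" and "t = (cmod x2)\<^sup>2"
  have "s < 1" "t < 1"
    using tetrablock_less_1[of x1 x2 x3] tetrablock_less_1[of x2 x1 x3] tetrablock_swap[of x1 x2 x3] *
    by (auto simp: s_def t_def power_less_one_iff)
  then have "s + t < 2" "0 < (1 - s) * (1 - t)"
    by simp_all
  then have "opnorm (mat22 x1 0 0 x2) < 1"
    unfolding opnorm_mat22_less_1_iff
    by (simp add: norm_mult power_mult_distrib algebra_simps flip: s_def t_def)
  with * show "(0, x1, x2, x3) \<in> normed_hexablock"
    by (auto simp: normed_hexablock_iff)
qed (auto simp: normed_hexablock_iff dest: tetrablock_of_contraction)

text \<open>
  The trace condition of \<open>opnorm_mat22_less_1_iff\<close> reads \<open>s < 2\<close> for the sum \<open>s\<close> of the squared moduli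
  of the entries.  In the tetrablock it follows from the determinant condition
  \<open>s < 1 + |x\<^sub>3|\<^sup>2\<close>, because \<open>|x\<^sub>3| < 1\<close>.
\<close>
lemma normed_hexablock_nonzero_iff:
  fixes a x1 x2 x3 :: complex
  assumes "a \<noteq> 0"
  defines "b \<equiv> (x1 * x2 - x3) / a"
  shows "(a, x1, x2, x3) \<in> normed_hexablock \<longleftrightarrow> (x1, x2, x3) \<in> tetrablock \<and>
    0 < 1 - (cmod x1)\<^sup>2 - (cmod x2)\<^sup>2 + (cmod x3)\<^sup>2 - (cmod a)\<^sup>2 - (cmod b)\<^sup>2"
proof -
  have b: "x3 = x1 * x2 - c * a \<longleftrightarrow> c = b" for c
    using \<open>a \<noteq> 0\<close> by (auto simp: b_def field_simps)
  then have x3: "x1 * x2 - b * a = x3"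
    by metis
  have "(a, x1, x2, x3) \<in> normed_hexablock \<longleftrightarrow> opnorm (mat22 x1 b a x2) < 1"
    unfolding normed_hexablock_iff b by auto
  then show ?thesis
    using tetrablock_third_less_1[of x1 x2 x3] normed_hexablock_imp_tetrablock[of a x1 x2 x3]
    unfolding opnorm_mat22_less_1_iff x3 by auto
qed

text \<open>
  Multiplying by \<open>t\<close> gives \<open>t\<^sup>2 - \<beta> t + m < 0\<close>, which becomes \<open>|2 t - \<beta>| < sqrt (\<beta>\<^sup>2 - 4 m)\<close> after
  completing the square.  The argument also covers a negative discriminant: \<open>sqrt\<close> is strictly
  increasing on all reals and negative there, so both sides are false.
\<close>
lemma between_roots_iff:
  fixes t \<beta> m :: real
  assumes "0 < t"
  shows "0 < \<beta> - t - m / t \<longleftrightarrow>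
    (\<beta> - sqrt (\<beta>\<^sup>2 - 4 * m)) / 2 < t \<and> t < (\<beta> + sqrt (\<beta>\<^sup>2 - 4 * m)) / 2"
proof -
  have "\<beta>\<^sup>2 - 4 * m - (2 * t - \<beta>)\<^sup>2 = 4 * t * (\<beta> - t - m / t)"
    using assms by (simp add: field_simps power2_eq_square)
  then have "0 < \<beta> - t - m / t \<longleftrightarrow> (2 * t - \<beta>)\<^sup>2 < \<beta>\<^sup>2 - 4 * m"
    using assms by (smt (verit) zero_less_mult_iff)
  also have "\<dots> \<longleftrightarrow> sqrt ((2 * t - \<beta>)\<^sup>2) < sqrt (\<beta>\<^sup>2 - 4 * m)"
    by (simp only: real_sqrt_less_iff)
  also have "\<dots> \<longleftrightarrow> \<bar>2 * t - \<beta>\<bar> < sqrt (\<beta>\<^sup>2 - 4 * m)"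
    by simp
  finally show ?thesis
    by (auto simp: abs_less_iff)
qed

theorem theorem4p6:
  fixes a x1 x2 x3 w :: complex and \<beta> :: real
  assumes beta: "\<beta> = 1 - (cmod x1)\<^sup>2 - (cmod x2)\<^sup>2 + (cmod x3)\<^sup>2"
    and w: "w\<^sup>2 = x1 * x2 - x3"
  shows "((a, x1, x2, x3) \<in> normed_hexablock \<longleftrightarrow>
      (x1, x2, x3) \<in> tetrablock \<and>
      ((a, x1, x2, x3) = (0, x1, x2, x1 * x2) \<or>
       (a \<noteq> 0 \<and>
        (\<beta> - sqrt (\<beta>\<^sup>2 - 4 * (cmod w) ^ 4)) / 2 < (cmod a)\<^sup>2 \<and>
        (cmod a)\<^sup>2 < (\<beta> + sqrt (\<beta>\<^sup>2 - 4 * (cmod w) ^ 4)) / 2)))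
    \<and> ((a, x1, x2, x3) \<in> normed_hexablock \<longleftrightarrow>
      (x1, x2, x3) \<in> tetrablock \<and>
      ((a, x1, x2, x3) = (0, x1, x2, x1 * x2) \<or>
       (a \<noteq> 0 \<and>
        (let A = mat22 x1 (w\<^sup>2 / a) a x2 in det (mat 1 - cadjoint A ** A) > 0))))"
proof (cases "a = 0")
  case True
  then show ?thesis
    by (simp add: normed_hexablock_zero_iff)
next
  case False
  define b where "b = w\<^sup>2 / a"
  have b: "b = (x1 * x2 - x3) / a"
    by (simp add: b_def w)
  have ba: "x1 * x2 - b * a = x3"
    using False by (simp add: b)
  have hexa: "(a, x1, x2, x3) \<in> normed_hexablock \<longleftrightarrow>
      (x1, x2, x3) \<in> tetrablock \<and> 0 < \<beta> - (cmod a)\<^sup>2 - (cmod b)\<^sup>2"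
    using normed_hexablock_nonzero_iff[OF False, of x1 x2 x3, folded b] by (simp add: beta)
  have "(cmod b)\<^sup>2 = (cmod w) ^ 4 / (cmod a)\<^sup>2"
    by (simp add: b_def norm_divide norm_power power_divide flip: power_mult)
  then have roots: "0 < \<beta> - (cmod a)\<^sup>2 - (cmod b)\<^sup>2 \<longleftrightarrow>
      (\<beta> - sqrt (\<beta>\<^sup>2 - 4 * (cmod w) ^ 4)) / 2 < (cmod a)\<^sup>2 \<and>
      (cmod a)\<^sup>2 < (\<beta> + sqrt (\<beta>\<^sup>2 - 4 * (cmod w) ^ 4)) / 2"
    using between_roots_iff[of "(cmod a)\<^sup>2" \<beta> "(cmod w) ^ 4"] False by simp
  have "det (mat 1 - cadjoint (mat22 x1 b a x2) ** mat22 x1 b a x2)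
      = complex_of_real (\<beta> - (cmod a)\<^sup>2 - (cmod b)\<^sup>2)"
    unfolding det_defect ba beta by (simp add: algebra_simps)
  then have "det (mat 1 - cadjoint (mat22 x1 b a x2) ** mat22 x1 b a x2) > 0 \<longleftrightarrow>
      0 < \<beta> - (cmod a)\<^sup>2 - (cmod b)\<^sup>2"
    by (simp only: less_complex_def) simp
  with hexa roots False show ?thesis
    unfolding Let_def b_def[symmetric] by simp
qed

end
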